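(* Let $M \ge 2$, let $N=\{1,\dots,M\}$ be the set of features, and let $f:\mathcal{P}(N)\to\mathbb{R}$ be the function assigning to each coalition $S\subseteq N$ the value $f(S)=f_x(\mathbf{1}_S)$ of the model being explained at the instance $x$. Let $(\phi_1,\dots,\phi_M)$ be the attribution values computed by ST-SHAP when filling exactly Layer 1, that is, the solution of the weighted least squares problem of minimizing $$\sum_{\substack{z'\in\{0,1\}^M\\ |z'|\in\{1,M-1\}}} \pi_x(z')\Big(\phi_0+\sum_{i=1}^M\phi_i z'_i - f_x(z')\Big)^2$$ over $(\phi_0,\phi_1,\dots,\phi_M)\in\mathbb{R}^{M+1}$ subject to the constraints $\phi_0=f(\emptyset)$ and $\sum_{i=1}^M\phi_i=f(N)-f(\emptyset)$. Then for every feature $j\in N$, $$\phi_j=\tilde\phi_j+\frac{1}{M}\left(f(N)-f(\emptyset)-\sum_{i=1}^M\tilde\phi_i\right),$$ where, for every $i\in N$, $$\tilde\phi_i=\frac{f(\{i\})-f(\emptyset)+f(N)-f(N\setminus\{i\})}{2}.$$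
   Context: A coalition is a subset $S\subseteq N$, identified with the binary vector $\mathbf{1}_S\in\{0,1\}^M$ given by $(\mathbf{1}_S)_i=1$ if $i\in S$ and $0$ otherwise; $|z'|$ denotes the number of $1$s in $z'\in\{0,1\}^M$. The number $f_x(z')$ is the average (conditional expectation) of the model's output when the features $i$ with $z'_i=1$ are fixed to their values in the instance $x$; for the statement $f$ may be regarded simply as a real-valued function on $\mathcal{P}(N)$, with $f_x(\mathbf{1}_S)=f(S)$. The Shapley kernel is $$\pi_x(z')=\frac{M-1}{\binom{M}{|z'|}\,|z'|\,(M-|z'|)}\qquad (1\le |z'|\le M-1).$$ It is infinite for $|z'|\in\{0,M\}$, which is interpreted as imposing the constraints $\phi_0=f(\emptyset)$ and $\sum_{i=1}^M\phi_i=f(N)-f(\emptyset)$ (the latter is called local accuracy). Layer 1 is the set of coalitions $z'$ with exactly one feature present or exactly one feature absent, i.e. $|z'|=1$ or $|z'|=M-1$. Kernel SHAP and ST-SHAP fit a linear surrogate $g(z')=\phi_0+\sum_{i=1}^M\phi_i z'_i$ by weighted least squares with weights $\pi_x$ on a chosen set of coalitions, under the constraints $\phi_0=f(\emptyset)$ and $\sum_{i=1}^M\phi_i=f(N)-f(\emptyset)$, and the attribution value of feature $j$ is the coefficient $\phi_j$. ST-SHAP "filling exactly Layer 1" means that the chosen set of coalitions is exactly Layer 1. *)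

theory Defs
  imports Complex_Main "HOL-Library.FuncSet" "HOL-Library.Indicator_Function"
begin

text \<open>
  The feature set is \<open>{1..M}\<close>. A coalition is a set \<open>S \<subseteq> {1..M}\<close>; its binary vector
  \<open>z'\<close> is \<open>indicator S\<close>, so \<open>|z'|\<close> is \<open>card S\<close>. A value function \<open>f\<close> is evaluated only
  on subsets of \<open>{1..M}\<close>.
\<close>

abbreviation features :: "nat \<Rightarrow> nat set" where
  "features M \<equiv> {1..M}"

text \<open>
  For the empty and the full coalition the kernel is infinite on paper, which is expressed by the
  constraints in \<open>feasible\<close> below; the value \<open>0\<close> that division by zero gives there is not meaningful.
\<close>

definition shapley_kernel :: "nat \<Rightarrow> nat set \<Rightarrow> real" where
  "shapley_kernel M S =
     (real M - 1) /
     (real (M choose card S) * real (card S) * (real M - real (card S)))"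

text \<open>
  For \<open>M = 2\<close> the two conditions on the cardinality coincide, and each coalition still occurs once.
\<close>

definition layer1 :: "nat \<Rightarrow> nat set set" where
  "layer1 M = {S. S \<subseteq> features M \<and> (card S = 1 \<or> card S = M - 1)}"

text \<open>
  A parameter vector \<open>(\<phi>\<^sub>0, \<phi>\<^sub>1, \<dots>, \<phi>\<^sub>M)\<close> is a function on \<open>{0..M}\<close>, with the intercept at index \<open>0\<close>.
\<close>

definition surrogate :: "nat \<Rightarrow> (nat \<Rightarrow> real) \<Rightarrow> nat set \<Rightarrow> real" where
  "surrogate M \<phi> S = \<phi> 0 + (\<Sum>i\<in>features M. \<phi> i * indicator S i)"

definition weighted_loss ::
  "nat \<Rightarrow> (nat set \<Rightarrow> real) \<Rightarrow> nat set set \<Rightarrow> (nat \<Rightarrow> real) \<Rightarrow> real" where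
  "weighted_loss M f \<C> \<phi> = (\<Sum>S\<in>\<C>. shapley_kernel M S * (surrogate M \<phi> S - f S)\<^sup>2)"

text \<open>
  The extensional function space \<open>{0..M} \<rightarrow>\<^sub>E UNIV\<close> represents the space of real vectors of length
  \<open>M + 1\<close>: values outside \<open>{0..M}\<close> are fixed, so that two equal vectors are equal functions.
\<close>

definition feasible :: "nat \<Rightarrow> (nat set \<Rightarrow> real) \<Rightarrow> (nat \<Rightarrow> real) \<Rightarrow> bool" where
  "feasible M f \<phi> \<longleftrightarrow>
     \<phi> \<in> {0..M} \<rightarrow>\<^sub>E UNIV \<and>
     \<phi> 0 = f {} \<and>
     (\<Sum>i\<in>features M. \<phi> i) = f (features M) - f {}"

definition shap_solution ::
  "nat \<Rightarrow> (nat set \<Rightarrow> real) \<Rightarrow> nat set set \<Rightarrow> (nat \<Rightarrow> real) \<Rightarrow> bool" where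
  "shap_solution M f \<C> \<phi> \<longleftrightarrow> is_arg_min (weighted_loss M f \<C>) (feasible M f) \<phi>"

definition phi_tilde :: "nat \<Rightarrow> (nat set \<Rightarrow> real) \<Rightarrow> nat \<Rightarrow> real" where
  "phi_tilde M f i =
     (f {i} - f {} + f (features M) - f (features M - {i})) / 2"

end

theory Submission
  imports Defs
begin

text \<open>
  On Layer 1 the Shapley kernel is the constant \<open>1 / M\<close>. Under the constraints the residual at
  \<open>{i}\<close> is \<open>\<phi>\<^sub>i - (f {i} - f {})\<close> and the residual at \<open>N - {i}\<close> is, up to sign,
  \<open>\<phi>\<^sub>i - (f N - f (N - {i}))\<close>; the two squares add up to twice the square of the distance of
  \<open>\<phi>\<^sub>i\<close> from the midpoint \<open>phi_tilde M f i\<close>, plus a constant. So the problem is to project the vector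
  of midpoints orthogonally onto a hyperplane with normal \<open>(1, \<dots>, 1)\<close>.
\<close>

definition layer1_solution :: "nat \<Rightarrow> (nat set \<Rightarrow> real) \<Rightarrow> nat \<Rightarrow> real" where
  "layer1_solution M f = (\<lambda>i\<in>{0..M}. if i = 0 then f {} else
     phi_tilde M f i +
     1 / real M * (f (features M) - f {} - (\<Sum>i\<in>features M. phi_tilde M f i)))"

text \<open>The set \<open>N - S\<close> has cardinality 1, so exactly one element is missing from
  \<open>S\<close>. Non-emptiness guards against truncated subtraction: for \<open>N = {}\<close>
  the left side would hold with \<open>S = {}\<close>.\<close>

lemma subset_card_pred_iff:
  assumes "finite N" "N \<noteq> {}"
  shows "S \<subseteq> N \<and> card S = card N - 1 \<longleftrightarrow> (\<exists>i\<in>N. S = N - {i})"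
proof
  assume S: "S \<subseteq> N \<and> card S = card N - 1"
  have "card N > 0" using assms by (simp add: card_gt_0_iff)
  moreover have "finite S" using S assms(1) finite_subset by blast
  ultimately have "card (N - S) = 1"
    using S by (simp add: card_Diff_subset)
  then obtain i where "N - S = {i}" by (auto simp: card_1_singleton_iff)
  then show "\<exists>i\<in>N. S = N - {i}" using S by blast
qed (use assms in auto)

lemma layer1_eq:
  assumes "M \<ge> 1"
  shows "layer1 M = (\<lambda>i. {i}) ` features M \<union> (\<lambda>i. features M - {i}) ` features M"
proof -
  have "S \<subseteq> features M \<and> card S = 1 \<longleftrightarrow> (\<exists>i\<in>features M. S = {i})" for S
    by (auto simp: card_1_singleton_iff)
  moreover have "S \<subseteq> features M \<and> card S = M - 1 \<longleftrightarrow> (\<exists>i\<in>features M. S = features M - {i})" for S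
    using subset_card_pred_iff[of "features M" S] assms by simp
  ultimately show ?thesis
    unfolding layer1_def by (simp only: conj_disj_distribL) (auto simp only: image_iff)
qed

text \<open>For \<open>M > 2\<close> the singletons and their complements form disjoint families.
  For \<open>M = 2\<close> the two families coincide, so the right-hand sum meets each coalition
  twice and has to be halved.\<close>

lemma sum_layer1:
  fixes g :: "nat set \<Rightarrow> real"
  assumes "M \<ge> 2"
  shows "(\<Sum>S\<in>layer1 M. g S) =
    (if M = 2 then 1 / 2 else 1) * (\<Sum>i\<in>features M. g {i} + g (features M - {i}))"
proof -
  let ?A = "(\<lambda>i. {i}) ` features M" and ?B = "(\<lambda>i. features M - {i}) ` features M"
  have B: "(\<Sum>S\<in>?B. g S) = (\<Sum>i\<in>features M. g (features M - {i}))"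
    by (subst sum.reindex) (auto simp: inj_on_def)
  have A: "(\<Sum>S\<in>?A. g S) = (\<Sum>i\<in>features M. g {i})"
    by (subst sum.reindex) auto
  have L: "layer1 M = ?A \<union> ?B" using assms by (intro layer1_eq) simp
  show ?thesis
  proof (cases "M = 2")
    case True
    have "features M = {1, 2}" using True by auto
    then have "?A = ?B" by auto
    then show ?thesis using True A B L by (simp add: sum.distrib)
  next
    case False
    have "?A \<inter> ?B = {}"
    proof (rule ccontr)
      assume "?A \<inter> ?B \<noteq> {}"
      then obtain i j where ij: "{i} = features M - {j}" "j \<in> features M" by blast
      have "card {i} = M - 1" unfolding ij(1) using ij(2) by simp
      then show False using False assms by simp
    qed
    then show ?thesis using False A B L by (simp add: sum.union_disjoint sum.distrib)
  qed
qed

text \<open>At sizes 1 and \<open>M - 1\<close> the binomial coefficient is \<open>M\<close>, and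
  the product of the two remaining factors is \<open>M - 1\<close>, which cancels the
  numerator.\<close>

lemma shapley_kernel_layer1:
  assumes "M \<ge> 2" "S \<in> layer1 M"
  shows "shapley_kernel M S = 1 / real M"
proof -
  have "M choose (M - 1) = M" using assms(1) binomial_symmetric[of 1 M] by simp
  then show ?thesis using assms
    by (auto simp: layer1_def shapley_kernel_def of_nat_diff field_simps)
qed

lemma surrogate_eq:
  assumes "S \<subseteq> features M"
  shows "surrogate M \<phi> S = \<phi> 0 + (\<Sum>i\<in>S. \<phi> i)"
proof -
  have "(\<Sum>i\<in>features M. \<phi> i * indicator S i) = (\<Sum>i\<in>S. \<phi> i)"
    using assms by (intro sum.mono_neutral_cong_right) (auto simp: indicator_def)
  then show ?thesis by (simp add: surrogate_def)
qed

lemma weighted_loss_layer1: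
  assumes "M \<ge> 2" "feasible M f \<phi>"
  shows "weighted_loss M f (layer1 M) \<phi> = (if M = 2 then 1 / 2 else 1) / real M *
    (\<Sum>i\<in>features M. 2 * (\<phi> i - phi_tilde M f i)\<^sup>2 +
       (f {i} - f {} - f (features M) + f (features M - {i}))\<^sup>2 / 2)"
proof -
  let ?r = "\<lambda>S. (surrogate M \<phi> S - f S)\<^sup>2"
  have res: "?r {i} + ?r (features M - {i}) = 2 * (\<phi> i - phi_tilde M f i)\<^sup>2 +
      (f {i} - f {} - f (features M) + f (features M - {i}))\<^sup>2 / 2" if "i \<in> features M" for i
  proof -
    have "surrogate M \<phi> {i} = f {} + \<phi> i"
      using assms(2) that by (simp add: surrogate_eq feasible_def)
    \<comment> \<open>By local accuracy the other coefficients add up to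
      \<open>f (features M) - f {} - \<phi> i\<close>, so this residual also depends on coordinate
      \<open>i\<close> alone and the loss separates.\<close>
    moreover have "surrogate M \<phi> (features M - {i}) = f (features M) - \<phi> i"
      using assms(2) that by (simp add: surrogate_eq feasible_def sum_diff1)
    \<comment> \<open>The identity is (x - a)^2 + (x - b)^2 = 2 (x - (a + b)/2)^2 + (a - b)^2 / 2,
      where a and b are the marginal contributions of \<open>i\<close> to \<open>{}\<close> and to
      \<open>features M - {i}\<close>.\<close>
    ultimately show ?thesis
      unfolding phi_tilde_def by (simp only:) (simp add: power2_eq_square field_simps)
  qed
  have "weighted_loss M f (layer1 M) \<phi> = 1 / real M * (\<Sum>S\<in>layer1 M. ?r S)"
    unfolding weighted_loss_def sum_distrib_left
    using assms(1) by (intro sum.cong) (simp_all add: shapley_kernel_layer1)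
  also have "(\<Sum>S\<in>layer1 M. ?r S) =
      (if M = 2 then 1 / 2 else 1) * (\<Sum>i\<in>features M. ?r {i} + ?r (features M - {i}))"
    using assms(1) by (rule sum_layer1)
  also have "(\<Sum>i\<in>features M. ?r {i} + ?r (features M - {i})) =
      (\<Sum>i\<in>features M. 2 * (\<phi> i - phi_tilde M f i)\<^sup>2 +
        (f {i} - f {} - f (features M) + f (features M - {i}))\<^sup>2 / 2)"
    by (rule sum.cong[OF refl res])
  finally show ?thesis by (simp only: times_divide_eq_left mult_1_left mult.assoc)
qed

text \<open>Each of the \<open>M\<close> coordinates receives an equal share of the deficit in local
  accuracy, so the shifts add up to exactly that deficit.\<close>

lemma feasible_layer1_solution:
  assumes "M \<ge> 1"
  shows "feasible M f (layer1_solution M f)"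
  using assms by (simp add: feasible_def layer1_solution_def sum.distrib)

text \<open>Pythagoras: \<open>p - t\<close> is constant on \<open>A\<close> and
  \<open>x - p\<close> sums to 0 there, so the two are orthogonal and the cross term
  vanishes.\<close>

lemma sum_sq_dist_hyperplane:
  fixes x p t :: "'a \<Rightarrow> real"
  assumes "\<And>i. i \<in> A \<Longrightarrow> p i = t i + d" "sum x A = sum p A"
  shows "(\<Sum>i\<in>A. (x i - t i)\<^sup>2) = (\<Sum>i\<in>A. (p i - t i)\<^sup>2) + (\<Sum>i\<in>A. (x i - p i)\<^sup>2)"
proof -
  have "(x i - t i)\<^sup>2 = (p i - t i)\<^sup>2 + (x i - p i)\<^sup>2 + 2 * d * (x i - p i)" if "i \<in> A" for i
    using assms(1)[OF that] by (simp add: power2_eq_square algebra_simps)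
  then have "(\<Sum>i\<in>A. (x i - t i)\<^sup>2) =
      (\<Sum>i\<in>A. (p i - t i)\<^sup>2 + (x i - p i)\<^sup>2 + 2 * d * (x i - p i))"
    by (intro sum.cong) simp_all
  also have "\<dots> = (\<Sum>i\<in>A. (p i - t i)\<^sup>2) + (\<Sum>i\<in>A. (x i - p i)\<^sup>2) + 2 * d * (sum x A - sum p A)"
    by (simp add: sum.distrib sum_subtractf flip: sum_distrib_left)
  finally show ?thesis using assms(2) by simp
qed

text \<open>The terms independent of \<open>\<phi>\<close> cancel, and Pythagoras handles the rest.
  Since the excess is a positive multiple of a squared distance, minimality and uniqueness both
  follow without derivatives.\<close>

lemma weighted_loss_layer1_excess:
  assumes "M \<ge> 2" "feasible M f \<phi>"
  shows "weighted_loss M f (layer1 M) \<phi> = weighted_loss M f (layer1 M) (layer1_solution M f) +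
    (if M = 2 then 1 / 2 else 1) * 2 / real M *
      (\<Sum>i\<in>features M. (\<phi> i - layer1_solution M f i)\<^sup>2)"
proof -
  let ?p = "layer1_solution M f"
  have feas: "feasible M f ?p" using assms(1) by (intro feasible_layer1_solution) simp
  have "(\<Sum>i\<in>features M. (\<phi> i - phi_tilde M f i)\<^sup>2) =
      (\<Sum>i\<in>features M. (?p i - phi_tilde M f i)\<^sup>2) + (\<Sum>i\<in>features M. (\<phi> i - ?p i)\<^sup>2)"
  proof (rule sum_sq_dist_hyperplane)
    show "?p i = phi_tilde M f i +
        1 / real M * (f (features M) - f {} - (\<Sum>i\<in>features M. phi_tilde M f i))"
      if "i \<in> features M" for i
      using that by (simp add: layer1_solution_def)
    show "sum \<phi> (features M) = sum ?p (features M)"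
      using assms(2) feas by (simp add: feasible_def)
  qed
  then show ?thesis
    unfolding weighted_loss_layer1[OF assms] weighted_loss_layer1[OF assms(1) feas]
      sum.distrib sum_distrib_left[symmetric]
    by (simp add: algebra_simps)
qed

lemma shap_solution_layer1_iff:
  assumes "M \<ge> 2"
  shows "shap_solution M f (layer1 M) \<phi> \<longleftrightarrow> \<phi> = layer1_solution M f"
proof
  let ?p = "layer1_solution M f" and ?L = "weighted_loss M f (layer1 M)"
  have feas: "feasible M f ?p" using assms by (intro feasible_layer1_solution) simp
  show "shap_solution M f (layer1 M) \<phi>" if "\<phi> = ?p"
  proof -
    have "?L ?p \<le> ?L y" if "feasible M f y" for y
      unfolding weighted_loss_layer1_excess[OF assms that] by (simp add: sum_nonneg)
    then show ?thesis
      using feas \<open>\<phi> = ?p\<close> by (auto simp: shap_solution_def is_arg_min_linorder)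
  qed
  assume "shap_solution M f (layer1 M) \<phi>"
  then have \<phi>: "feasible M f \<phi>" and "?L \<phi> \<le> ?L ?p"
    using feas by (auto simp: shap_solution_def is_arg_min_linorder)
  \<comment> \<open>The excess over the loss of \<open>?p\<close> is nonpositive, and its factor is
    positive whether or not \<open>M = 2\<close>.\<close>
  then have "(\<Sum>i\<in>features M. (\<phi> i - ?p i)\<^sup>2) \<le> 0"
    using assms weighted_loss_layer1_excess[OF assms \<phi>]
    by (auto simp: field_simps split: if_splits)
  then have "(\<Sum>i\<in>features M. (\<phi> i - ?p i)\<^sup>2) = 0"
    by (intro antisym sum_nonneg) simp_all
  then have eq: "\<phi> i = ?p i" if "i \<in> features M" for i
    using that by (simp add: sum_nonneg_eq_0_iff)
  show "\<phi> = ?p"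
  \<comment> \<open>The vanishing distance says nothing about index 0, where the intercept
    constraint decides, nor about arguments beyond \<open>M\<close>, where extensionality
    does.\<close>
  proof (rule PiE_ext)
    show "\<phi> \<in> {0..M} \<rightarrow>\<^sub>E UNIV" "?p \<in> {0..M} \<rightarrow>\<^sub>E UNIV"
      using \<phi> feas by (simp_all add: feasible_def)
    show "\<phi> i = ?p i" if "i \<in> {0..M}" for i
      using that eq[of i] \<phi> feas by (cases "i = 0") (simp_all add: feasible_def)
  qed
qed

theorem theorem1:
  fixes M :: nat and f :: "nat set \<Rightarrow> real"
  assumes "M \<ge> 2"
  shows "(\<exists>!\<phi>. shap_solution M f (layer1 M) \<phi>) \<and>
    (\<forall>\<phi>. shap_solution M f (layer1 M) \<phi> \<longrightarrow>
      (\<forall>j\<in>features M. \<phi> j =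
         phi_tilde M f j +
         1 / real M * (f (features M) - f {} - (\<Sum>i\<in>features M. phi_tilde M f i))))"
  using assms by (simp add: shap_solution_layer1_iff layer1_solution_def)

end
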